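(* Let $G$ be a strong tournament on $n\geq 3$ vertices, that is, a directed complete graph in which for any two vertices $x,y$ there is a directed path from $x$ to $y$. Then there exist an integer $m\ge 3$, a set of $n$ $m$-sided dice $A_1,\dots,A_n$, and a bijection $f:\{A_1,\dots,A_n\}\to V(G)$ with the following properties. The dice are non-transitive: $P(A_i\succ A_{i+1})>\tfrac12$ for $i<n$ and $P(A_n\succ A_1)>\tfrac12$. They are balanced: $P(A_1\succ A_2)=\dots=P(A_{n-1}\succ A_n)=P(A_n\succ A_1)$. They realize $G$ via $f$: for all distinct dice $A,B$, if $P(A\succ B)>\tfrac12$ then $(f(A),f(B))$ is a directed edge of $G$.
   Context: A set of $n$ $m$-sided dice is a collection of pairwise-disjoint sets $A_1,\dots,A_n$ with $|A_i|=m$ and $\bigcup_i A_i=\{1,\dots,nm\}$. Each die is rolled by choosing one of its $m$ labels uniformly at random. $P(A\succ B)$ is the probability that, when $A$ and $B$ are rolled independently, the number on $A$ exceeds the number on $B$; that is, $|\{(a,b)\in A\times B:a>b\}|/m^2$. One writes $A\succ B$ if $P(A\succ B)>\tfrac12$. A directed graph $G$ is realizable by a set of dice $D$ if there is a one-to-one map $f:D\to V(G)$ such that, for all $A,B\in D$, $P(A\succ B)>\tfrac12$ implies that $(f(A),f(B))$ is a directed edge of $G$. *)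

theory Defs
  imports "HOL-Probability.Probability" "Graph_Theory.Digraph_Component"
begin

definition tournament :: "('v, 'e) pre_digraph \<Rightarrow> bool" where
  "tournament G \<longleftrightarrow> digraph G \<and>
     (\<forall>x \<in> verts G. \<forall>y \<in> verts G. x \<noteq> y \<longrightarrow>
        ((x, y) \<in> arcs_ends G \<longleftrightarrow> (y, x) \<notin> arcs_ends G))"

definition dice_set :: "nat \<Rightarrow> nat \<Rightarrow> (nat \<Rightarrow> nat set) \<Rightarrow> bool" where
  "dice_set n m A \<longleftrightarrow> disjoint_family_on A {1..n} \<and>
     (\<forall>i \<in> {1..n}. card (A i) = m) \<and> (\<Union>i \<in> {1..n}. A i) = {1..n * m}"

definition prob_beats :: "nat set \<Rightarrow> nat set \<Rightarrow> real" where
  "prob_beats A B =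
     measure_pmf.prob (pair_pmf (pmf_of_set A) (pmf_of_set B)) {(a, b). a > b}"

text \<open>\<^const>\<open>pmf_of_set\<close> is unspecified on empty and on infinite sets, so the counting
  formula needs the side conditions below; they hold for all dice with \<open>m > 0\<close> sides.\<close>

lemma prob_beats_eq_card:
  assumes "finite A" "A \<noteq> {}" "finite B" "B \<noteq> {}"
  shows "prob_beats A B =
    real (card {(a, b) \<in> A \<times> B. a > b}) / (real (card A) * real (card B))"
proof -
  have "pair_pmf (pmf_of_set A) (pmf_of_set B) = pmf_of_set (A \<times> B)"
  proof (rule pmf_eqI)
    fix z :: "nat \<times> nat"
    obtain a b where z: "z = (a, b)" by (cases z)
    show "pmf (pair_pmf (pmf_of_set A) (pmf_of_set B)) z = pmf (pmf_of_set (A \<times> B)) z"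
      using pmf_of_set[OF assms(2,1), of a] pmf_of_set[OF assms(4,3), of b]
        pmf_of_set[of "A \<times> B" z] assms
      by (simp add: z pmf_pair indicator_def card_cartesian_product)
  qed
  moreover have "A \<times> B \<inter> {(a, b). a > b} = {(a, b) \<in> A \<times> B. a > b}"
    by auto
  ultimately show ?thesis
    using assms by (simp add: prob_beats_def measure_pmf_of_set card_cartesian_product)
qed

end

theory Submission
  imports Defs
begin

text \<open>A strong tournament has a Hamiltonian cycle (Camion), so, since ties are permitted by
  realizability, it suffices to find dice \<open>A\<^sub>1, \<dots>, A\<^sub>n\<close> that beat each other along the cycle with
  equal probability and tie otherwise. Cut \<open>{1..nm}\<close> into \<open>m\<close> consecutive blocks of length \<open>n\<close> and
  let each die take one label from each block, so that block \<open>s\<close> is a permutation of the dice.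
  Labels from different blocks cancel out, so \<open>A\<^sub>i \<succ> A\<^sub>j\<close> iff \<open>i\<close> is ranked above \<open>j\<close> by a majority
  of the permutations. Following McGarvey, for every arc \<open>x \<rightarrow> y\<close> of the cycle one uses the two
  rankings \<open>x, y, z\<^sub>1, \<dots>, z\<^sub>k\<close> and \<open>z\<^sub>k, \<dots>, z\<^sub>1, x, y\<close>, which cancel except on the pair \<open>x, y\<close>;
  hence \<open>m = 2n\<close>.\<close>

section \<open>Hamiltonian cycles in strong tournaments\<close>

text \<open>A single vertex counts as a cycle; it starts the maximality argument.\<close>

definition cycle_list :: "('v, 'e) pre_digraph \<Rightarrow> 'v list \<Rightarrow> bool" where
  "cycle_list G xs \<longleftrightarrow> xs \<noteq> [] \<and> distinct xs \<and> set xs \<subseteq> verts G \<and>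
     successively (\<lambda>x y. (x, y) \<in> arcs_ends G) xs \<and>
     (length xs > 1 \<longrightarrow> (last xs, hd xs) \<in> arcs_ends G)"

lemma cycle_list_rotate:
  assumes "cycle_list G (as @ y # bs)"
  shows "cycle_list G (y # bs @ as)"
proof (cases "as = []")
  case True
  then show ?thesis using assms by simp
next
  case False
  then show ?thesis using assms
    by (cases bs) (auto simp: cycle_list_def successively_append_iff successively_Cons hd_append)
qed

lemma cycle_list_insert:
  assumes "cycle_list G xs" "v \<in> verts G" "v \<notin> set xs"
    and tot: "\<And>x. x \<in> set xs \<Longrightarrow> (x, v) \<in> arcs_ends G \<or> (v, x) \<in> arcs_ends G"
    and "x \<in> set xs" "(x, v) \<in> arcs_ends G" "y \<in> set xs" "(v, y) \<in> arcs_ends G"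
  shows "\<exists>ys. cycle_list G ys \<and> length ys = Suc (length xs)"
proof -
  obtain as bs where xs: "xs = as @ y # bs"
    using \<open>y \<in> set xs\<close> by (meson split_list)
  define zs where "zs = y # bs @ as"
  have zs: "cycle_list G zs" "set zs = set xs" "length zs = length xs" "hd zs = y"
    using assms(1) cycle_list_rotate unfolding zs_def xs by auto
  have "\<exists>x\<in>set zs. (x, v) \<in> arcs_ends G"
    using assms zs by blast
  then obtain cs z ds where split: "zs = cs @ z # ds" "(z, v) \<in> arcs_ends G"
    "\<forall>d\<in>set ds. (d, v) \<notin> arcs_ends G"
    using split_list_last_prop[of zs "\<lambda>x. (x, v) \<in> arcs_ends G"] by blast
  have ds: "(v, hd ds) \<in> arcs_ends G" if "ds \<noteq> []"
  proof -
    have "hd ds \<in> set ds" using that by simp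
    then have "hd ds \<in> set xs" "(hd ds, v) \<notin> arcs_ends G" using split zs(2) by auto
    then show ?thesis using tot by blast
  qed
  have hd: "hd (cs @ z # v # ds) = y"
    using zs(4) split(1) by (cases cs) auto
  have "cycle_list G (cs @ z # v # ds)"
  proof (cases "ds = []")
    case True
    then show ?thesis
      using zs split assms(2,3,8) hd
      by (auto simp: cycle_list_def successively_append_iff)
  next
    case False
    then have "(last ds, y) \<in> arcs_ends G"
      using zs split by (auto simp: cycle_list_def split: if_splits)
    then show ?thesis
      using zs split assms(2,3) hd ds False
      by (auto simp: cycle_list_def successively_append_iff successively_Cons)
  qed
  moreover have "length (cs @ z # v # ds) = Suc (length xs)"
    using zs(3) split(1) by simp
  ultimately show ?thesis by blast
qed

lemma cycle_list_append_two:
  assumes "cycle_list G xs" "w \<in> verts G" "u \<in> verts G" "w \<noteq> u" "w \<notin> set xs" "u \<notin> set xs"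
    and "(w, u) \<in> arcs_ends G" "(last xs, w) \<in> arcs_ends G" "(u, hd xs) \<in> arcs_ends G"
  shows "cycle_list G (xs @ [w, u])"
  using assms by (auto simp: cycle_list_def successively_append_iff)

lemma strongly_connected_cut_arc:
  assumes "strongly_connected G" "S \<subseteq> verts G" "a \<in> S" "b \<in> verts G" "b \<notin> S"
  shows "\<exists>x\<in>S. \<exists>y\<in>verts G - S. (x, y) \<in> arcs_ends G"
proof (rule ccontr)
  assume cl: "\<not> ?thesis"
  have "a \<rightarrow>\<^sup>*\<^bsub>G\<^esub> b"
    using assms by (auto simp: strongly_connected_def)
  then have "b \<in> S"
    unfolding reachable_def
  proof (induction rule: rtrancl_on_induct)
    case base
    then show ?case using assms by simp
  next
    case (step y z)
    then show ?case using cl by blast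
  qed
  then show False using assms by simp
qed

theorem strong_tournament_hamiltonian:
  assumes "tournament G" "strongly_connected G"
  shows "\<exists>xs. cycle_list G xs \<and> set xs = verts G"
proof -
  interpret digraph G using assms(1) unfolding tournament_def by blast
  have tot: "(x, y) \<in> arcs_ends G \<longleftrightarrow> (y, x) \<notin> arcs_ends G"
    if "x \<in> verts G" "y \<in> verts G" "x \<noteq> y" for x y
    using assms(1) that unfolding tournament_def by blast
  obtain v where "v \<in> verts G"
    using assms by (auto simp: strongly_connected_def)
  then have ex: "cycle_list G [v]" by (simp add: cycle_list_def)
  have bound: "length xs \<le> card (verts G)" if "cycle_list G xs" for xs
    using that card_mono[of "verts G" "set xs"] by (simp add: cycle_list_def distinct_card)
  have "\<exists>xs. cycle_list G xs \<and> (\<forall>ys. cycle_list G ys \<longrightarrow> length ys \<le> length xs)"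
    using ex bound
    by (intro ex_has_greatest_nat[where k = "[v]" and b = "Suc (card (verts G))"])
      (simp_all add: less_Suc_eq_le)
  then obtain xs where xs: "cycle_list G xs" and
    max: "\<And>ys. cycle_list G ys \<Longrightarrow> length ys \<le> length xs"
    by blast
  have sub: "set xs \<subseteq> verts G" and ne: "xs \<noteq> []"
    using xs by (auto simp: cycle_list_def)
  have ends: "hd xs \<in> set xs" "last xs \<in> set xs"
    using ne by auto
  have uniform: "(x, v) \<notin> arcs_ends G \<or> (v, y) \<notin> arcs_ends G"
    if "v \<in> verts G" "v \<notin> set xs" "x \<in> set xs" "y \<in> set xs" for v x y
  proof (rule ccontr)
    assume "\<not> ?thesis"
    moreover have "(x, v) \<in> arcs_ends G \<or> (v, x) \<in> arcs_ends G" if "x \<in> set xs" for x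
      using tot[of x v] that sub \<open>v \<in> verts G\<close> \<open>v \<notin> set xs\<close> by blast
    ultimately obtain ys where "cycle_list G ys" "length ys = Suc (length xs)"
      using cycle_list_insert[OF xs] \<open>v \<in> verts G\<close> \<open>v \<notin> set xs\<close> \<open>x \<in> set xs\<close> \<open>y \<in> set xs\<close>
      by blast
    then show False using max by fastforce
  qed
  have "set xs = verts G"
  proof (rule ccontr)
    assume neq: "set xs \<noteq> verts G"
    define W where "W = {w \<in> verts G - set xs. \<exists>x\<in>set xs. (x, w) \<in> arcs_ends G}"
    obtain b where "b \<in> verts G" "b \<notin> set xs"
      using neq sub by blast
    from strongly_connected_cut_arc[OF assms(2) sub ends(1) this]
    obtain w0 where "w0 \<in> W"
      unfolding W_def by blast
    moreover have "W \<subseteq> verts G" "hd xs \<in> verts G" "hd xs \<notin> W"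
      using ends sub unfolding W_def by auto
    ultimately obtain w u where wu: "w \<in> W" "u \<in> verts G - W" "(w, u) \<in> arcs_ends G"
      using strongly_connected_cut_arc[OF assms(2), of W w0 "hd xs"] by blast
    have w: "w \<in> verts G" "w \<notin> set xs"
      using wu by (auto simp: W_def)
    have out: "(w, x) \<notin> arcs_ends G" if "x \<in> set xs" for x
      using uniform w that wu(1) unfolding W_def by blast
    have u: "u \<in> verts G" "u \<notin> set xs" "w \<noteq> u"
      using wu out by auto
    have "(u, hd xs) \<in> arcs_ends G"
      using tot[of u "hd xs"] u wu(2) ends sub unfolding W_def by blast
    moreover have "(last xs, w) \<in> arcs_ends G"
      using tot[of "last xs" w] w out ends sub by blast
    ultimately have "cycle_list G (xs @ [w, u])"
      using cycle_list_append_two[OF xs] w u wu(3) by blast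
    then show False using max by fastforce
  qed
  then show ?thesis using xs by blast
qed

section \<open>Dice from rankings\<close>

definition ranking_die :: "nat \<Rightarrow> nat \<Rightarrow> (nat \<Rightarrow> nat \<Rightarrow> nat) \<Rightarrow> nat \<Rightarrow> nat set" where
  "ranking_die n m r i = (\<lambda>s. Suc (n * s + r s i)) ` {..<m}"

lemma block_eq_iff:
  fixes p q n s t :: nat
  assumes "p < n" "q < n"
  shows "n * s + p = n * t + q \<longleftrightarrow> s = t \<and> p = q"
  by (metis (no_types) add_left_cancel assms div_mult_self4 div_less add.right_neutral
      gr_implies_not0)

lemma block_less_iff:
  fixes p q n s t :: nat
  assumes "p < n" "q < n"
  shows "n * s + p < n * t + q \<longleftrightarrow> s < t \<or> s = t \<and> p < q"
proof -
  have *: "n * s + p < n * t + q" if "s < t" "p < n" for s t p q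
  proof -
    have "n * Suc s \<le> n * t" using that by (intro mult_le_mono2) simp
    then show ?thesis using that by simp
  qed
  show ?thesis
    using *[of s t p q] *[of t s q p] assms by (cases s t rule: linorder_cases) auto
qed

lemma dice_set_ranking_die:
  assumes r: "\<And>s. s < m \<Longrightarrow> bij_betw (r s) {..<n} {..<n}"
  shows "dice_set n m (\<lambda>i. ranking_die n m r (i - 1))"
proof -
  have lt: "r s i < n" if "s < m" "i < n" for s i
    using r[OF that(1)] that by (auto simp: bij_betw_def)
  have inj: "i = j" if "s < m" "i < n" "j < n" "r s i = r s j" for s i j
    using r[OF that(1)] that by (auto simp: bij_betw_def inj_on_def)
  have surj: "\<exists>i<n. r s i = q" if "s < m" "q < n" for s q
    using r[OF that(1)] that(2) by (metis bij_betw_imp_surj_on imageE lessThan_iff)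
  have card: "card (ranking_die n m r i) = m" if "i < n" for i
    unfolding ranking_die_def using lt that
    by (subst card_image) (auto simp: inj_on_def block_eq_iff)
  have disj: "ranking_die n m r i \<inter> ranking_die n m r j = {}" if "i < n" "j < n" "i \<noteq> j" for i j
  proof -
    have "Suc (n * s + r s i) \<noteq> Suc (n * t + r t j)" if "s < m" "t < m" for s t
      using block_eq_iff[of "r s i" n "r t j" s t] lt inj that \<open>i < n\<close> \<open>j < n\<close> \<open>i \<noteq> j\<close> by blast
    then show ?thesis unfolding ranking_die_def by blast
  qed
  have "(\<Union>i<n. ranking_die n m r i) = {1..n * m}"
  proof (intro set_eqI iffI)
    fix x assume "x \<in> (\<Union>i<n. ranking_die n m r i)"
    then obtain i s where "i < n" "s < m" "x = Suc (n * s + r s i)"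
      by (auto simp: ranking_die_def)
    then show "x \<in> {1..n * m}"
      using block_less_iff[of "r s i" n 0 s m] lt[of s i] by auto
  next
    fix x assume x: "x \<in> {1..n * m}"
    then have "n > 0" by (cases n) auto
    have "(x - 1) div n < m"
      using x by (intro less_mult_imp_div_less) (auto simp: mult.commute)
    moreover from this obtain i where "i < n" "r ((x - 1) div n) i = (x - 1) mod n"
      using surj \<open>n > 0\<close> by (meson mod_less_divisor)
    moreover from this have "x = Suc (n * ((x - 1) div n) + r ((x - 1) div n) i)"
      using x by simp
    ultimately show "x \<in> (\<Union>i<n. ranking_die n m r i)"
      unfolding ranking_die_def by blast
  qed
  moreover have "{..<n} = (\<lambda>i. i - 1) ` {1..n}"
    using image_Suc_atLeastAtMost[of 0 "n - 1"] by force
  ultimately have "(\<Union>i\<in>{1..n}. ranking_die n m r (i - 1)) = {1..n * m}"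
    by simp
  moreover have "disjoint_family_on (\<lambda>i. ranking_die n m r (i - 1)) {1..n}"
    unfolding disjoint_family_on_def by (intro ballI impI disj) auto
  ultimately show ?thesis
    using card by (auto simp: dice_set_def)
qed

lemma prob_beats_ranking_die:
  assumes r: "\<And>s i. s < m \<Longrightarrow> i < n \<Longrightarrow> r s i < n" and "m > 0" "i < n" "j < n"
  shows "prob_beats (ranking_die n m r i) (ranking_die n m r j) =
    1 / 2 + (real (card {s. s < m \<and> r s j < r s i}) - m / 2) / (real m)\<^sup>2"
proof -
  let ?D = "ranking_die n m r"
  let ?f = "\<lambda>k s. Suc (n * s + r s k)"
  have inj: "inj_on (?f k) {..<m}" if "k < n" for k
    using r that by (auto simp: inj_on_def block_eq_iff)
  have card: "card (?D k) = m" if "k < n" for k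
    unfolding ranking_die_def using inj[OF that] by (simp add: card_image)
  have fin: "finite (?D k)" "?D k \<noteq> {}" for k
    using \<open>m > 0\<close> by (auto simp: ranking_die_def)
  define S where "S = (SIGMA s:{..<m}. {..<s})"
  define T where "T = (\<lambda>s. (s, s)) ` {s. s < m \<and> r s j < r s i}"
  have "{(a, b) \<in> ?D i \<times> ?D j. a > b} = map_prod (?f i) (?f j) ` (S \<union> T)"
  proof (intro set_eqI iffI)
    fix x assume "x \<in> {(a, b) \<in> ?D i \<times> ?D j. a > b}"
    then obtain s t where st: "s < m" "t < m" "x = (?f i s, ?f j t)" "?f j t < ?f i s"
      by (auto simp: ranking_die_def)
    then have "t < s \<or> t = s \<and> r s j < r s i"
      using block_less_iff[of "r t j" n "r s i" t s] r assms by auto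
    then have "(s, t) \<in> S \<union> T" using st by (auto simp: S_def T_def)
    then show "x \<in> map_prod (?f i) (?f j) ` (S \<union> T)"
      using st(3) by force
  next
    fix x assume "x \<in> map_prod (?f i) (?f j) ` (S \<union> T)"
    then obtain s t where st: "(s, t) \<in> S \<union> T" "x = (?f i s, ?f j t)"
      by auto
    then have "s < m" "t < m" "t < s \<or> t = s \<and> r s j < r s i"
      by (auto simp: S_def T_def)
    then show "x \<in> {(a, b) \<in> ?D i \<times> ?D j. a > b}"
      using st block_less_iff[of "r t j" n "r s i" t s] r assms by (auto simp: ranking_die_def)
  qed
  moreover have "inj_on (map_prod (?f i) (?f j)) (S \<union> T)"
    by (rule inj_on_subset[OF map_prod_inj_on[OF inj[OF assms(3)] inj[OF assms(4)]]])
      (auto simp: S_def T_def)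
  ultimately have "card {(a, b) \<in> ?D i \<times> ?D j. a > b} = card (S \<union> T)"
    by (simp add: card_image)
  also have "\<dots> = card S + card T"
    by (rule card_Un_disjoint) (auto simp: S_def T_def)
  also have "card T = card {s. s < m \<and> r s j < r s i}"
    unfolding T_def by (rule card_image) (auto simp: inj_on_def)
  finally have "real (card {(a, b) \<in> ?D i \<times> ?D j. a > b}) =
      real (card S) + real (card {s. s < m \<and> r s j < r s i})"
    by simp
  moreover have "real (card S) = real m * (real m - 1) / 2"
  proof -
    have "card S = (\<Sum>s<m. s)" by (simp add: S_def)
    moreover have "real (\<Sum>s<m. s) = real m * (real m - 1) / 2"
      by (induction m) (auto simp: field_simps)
    ultimately show ?thesis by simp
  qed
  ultimately show ?thesis
    using \<open>m > 0\<close> prob_beats_eq_card[OF fin fin] card assms(3,4)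
    by (simp add: field_simps power2_eq_square)
qed

section \<open>McGarvey's rankings for a cycle\<close>

text \<open>The residue of \<open>i - k\<close> modulo \<open>n\<close>, for \<open>i, k < n\<close>.\<close>

definition cyclic_diff :: "nat \<Rightarrow> nat \<Rightarrow> nat \<Rightarrow> nat" where
  "cyclic_diff n i k = (if k \<le> i then i - k else i + n - k)"

text \<open>For the arc from \<open>k\<close> to \<open>k + 1\<close>, ranking \<open>k\<close> lists the vertices as \<open>k, k + 1, \<dots>, k - 1\<close> and
  ranking \<open>n + k\<close> lists them as \<open>k - 1, k - 2, \<dots>, k + 2, k, k + 1\<close>, both from the best to the
  worst.\<close>

definition cycle_ranking :: "nat \<Rightarrow> nat \<Rightarrow> nat \<Rightarrow> nat" where
  "cycle_ranking n s i =
     (if s < n then n - 1 - cyclic_diff n i s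
      else let d = cyclic_diff n i (s - n) in if d < 2 then 1 - d else d)"

lemma cyclic_diff_less: "i < n \<Longrightarrow> cyclic_diff n i k < n"
  by (auto simp: cyclic_diff_def)

lemma cyclic_diff_eq_iff:
  "i < n \<Longrightarrow> j < n \<Longrightarrow> k < n \<Longrightarrow> cyclic_diff n i k = cyclic_diff n j k \<longleftrightarrow> i = j"
  by (auto simp: cyclic_diff_def)

lemma cyclic_diff_eq_0_iff: "i < n \<Longrightarrow> k < n \<Longrightarrow> cyclic_diff n i k = 0 \<longleftrightarrow> k = i"
  by (auto simp: cyclic_diff_def)

lemma cyclic_diff_succ:
  assumes "i < n" "k < n"
  shows "cyclic_diff n (if Suc i = n then 0 else Suc i) k =
    (if Suc (cyclic_diff n i k) = n then 0 else Suc (cyclic_diff n i k))"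
  using assms by (auto simp: cyclic_diff_def)

lemma cycle_ranking_first_less_iff:
  assumes "i < n" "j < n" "k < n"
  shows "cycle_ranking n k j < cycle_ranking n k i \<longleftrightarrow> cyclic_diff n i k < cyclic_diff n j k"
  using assms cyclic_diff_less[of i n k] cyclic_diff_less[of j n k]
  by (auto simp: cycle_ranking_def)

lemma cycle_ranking_second_less_iff:
  assumes "i < n" "j < n" "k < n"
  shows "cycle_ranking n (n + k) j < cycle_ranking n (n + k) i \<longleftrightarrow>
    cyclic_diff n j k < cyclic_diff n i k \<and> \<not> (cyclic_diff n j k = 0 \<and> cyclic_diff n i k = 1) \<or>
    cyclic_diff n i k = 0 \<and> cyclic_diff n j k = 1"
  by (auto simp: cycle_ranking_def Let_def)

lemma bij_betw_cycle_ranking: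
  assumes "n \<ge> 2" "s < 2 * n"
  shows "bij_betw (cycle_ranking n s) {..<n} {..<n}"
proof -
  have "cycle_ranking n s i \<noteq> cycle_ranking n s j" if "i < n" "j < n" "i \<noteq> j" for i j
  proof (cases "s < n")
    case True
    then show ?thesis
      using cycle_ranking_first_less_iff[of i n j s] cycle_ranking_first_less_iff[of j n i s]
        cyclic_diff_eq_iff[of i n j s] that by auto
  next
    case False
    then have "s = n + (s - n)" "s - n < n" using assms by auto
    then show ?thesis
      using cycle_ranking_second_less_iff[of i n j "s - n"]
        cycle_ranking_second_less_iff[of j n i "s - n"] cyclic_diff_eq_iff[of i n j "s - n"] that
      by (metis less_irrefl linorder_neqE_nat)
  qed
  then have "inj_on (cycle_ranking n s) {..<n}"
    by (metis inj_onI lessThan_iff)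
  moreover have "cycle_ranking n s ` {..<n} \<subseteq> {..<n}"
    using assms cyclic_diff_less[of _ n] by (auto simp: cycle_ranking_def Let_def)
  ultimately show ?thesis
    by (simp add: bij_betw_def endo_inj_surj)
qed

lemma card_cycle_ranking:
  "card {s. s < 2 * n \<and> cycle_ranking n s j < cycle_ranking n s i} =
   card ({k. k < n \<and> cycle_ranking n k j < cycle_ranking n k i} \<union>
         {k. k < n \<and> cycle_ranking n (n + k) j < cycle_ranking n (n + k) i}) +
   card ({k. k < n \<and> cycle_ranking n k j < cycle_ranking n k i} \<inter>
         {k. k < n \<and> cycle_ranking n (n + k) j < cycle_ranking n (n + k) i})"
  (is "card ?S = card (?K \<union> ?L) + card (?K \<inter> ?L)")
proof -
  have "?S = ?K \<union> (+) n ` ?L"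
  proof (intro set_eqI iffI)
    fix s assume s: "s \<in> ?S"
    show "s \<in> ?K \<union> (+) n ` ?L"
    proof (cases "s < n")
      case False
      then have "s = n + (s - n)" "s - n \<in> ?L" using s by auto
      then show ?thesis by blast
    qed (use s in auto)
  qed auto
  then have "card ?S = card (?K \<union> (+) n ` ?L)"
    by (rule arg_cong)
  also have "\<dots> = card ?K + card ((+) n ` ?L)"
    by (rule card_Un_disjoint) auto
  also have "card ((+) n ` ?L) = card ?L"
    by (simp add: card_image)
  finally show ?thesis
    using card_Un_Int[of ?K ?L] by simp
qed

lemma card_cycle_ranking_succ:
  assumes "n \<ge> 3" "i < n"
  shows "card {s. s < 2 * n \<and>
    cycle_ranking n s (if Suc i = n then 0 else Suc i) < cycle_ranking n s i} = n + 1"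
proof -
  let ?j = "if Suc i = n then 0 else Suc i"
  let ?K = "{k. k < n \<and> cycle_ranking n k ?j < cycle_ranking n k i}"
  let ?L = "{k. k < n \<and> cycle_ranking n (n + k) ?j < cycle_ranking n (n + k) i}"
  have j: "?j < n" using assms by auto
  have K: "k \<in> ?K \<longleftrightarrow> Suc (cyclic_diff n i k) \<noteq> n" if "k < n" for k
    using cyclic_diff_less[OF assms(2), of k] that
    unfolding mem_Collect_eq cycle_ranking_first_less_iff[OF assms(2) j that]
      cyclic_diff_succ[OF assms(2) that] by auto
  have L: "k \<in> ?L \<longleftrightarrow> Suc (cyclic_diff n i k) = n \<or> k = i" if "k < n" for k
    using assms(1) that
    unfolding mem_Collect_eq cycle_ranking_second_less_iff[OF assms(2) j that]
      cyclic_diff_succ[OF assms(2) that] cyclic_diff_eq_0_iff[OF assms(2) that, symmetric] by auto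
  have "k \<in> ?K \<union> ?L \<longleftrightarrow> k \<in> {..<n}" for k
    using K[of k] L[of k] by blast
  then have "?K \<union> ?L = {..<n}" by blast
  moreover have "k \<in> ?K \<inter> ?L \<longleftrightarrow> k = i" for k
    using K[of k] L[of k] cyclic_diff_eq_0_iff[OF assms(2), of k] assms by auto
  then have "?K \<inter> ?L = {i}" by blast
  ultimately show ?thesis
    unfolding card_cycle_ranking by simp
qed

lemma card_cycle_ranking_gt:
  assumes "i < n" "j < n"
    and "card {s. s < 2 * n \<and> cycle_ranking n s j < cycle_ranking n s i} > n"
  shows "j = (if Suc i = n then 0 else Suc i)"
proof -
  let ?K = "{k. k < n \<and> cycle_ranking n k j < cycle_ranking n k i}"
  let ?L = "{k. k < n \<and> cycle_ranking n (n + k) j < cycle_ranking n (n + k) i}"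
  have "card (?K \<union> ?L) \<le> card {..<n}"
    by (rule card_mono) auto
  then have "card (?K \<inter> ?L) > 0"
    using assms(3) unfolding card_cycle_ranking by simp
  then have "?K \<inter> ?L \<noteq> {}"
    unfolding card_gt_0_iff by (rule conjunct1)
  then obtain k where "k \<in> ?K \<inter> ?L"
    by blast
  then have k: "k < n" "cycle_ranking n k j < cycle_ranking n k i"
    "cycle_ranking n (n + k) j < cycle_ranking n (n + k) i"
    by auto
  have "cyclic_diff n i k = 0 \<and> cyclic_diff n j k = 1"
    using k assms(1,2) cycle_ranking_first_less_iff[of i n j k]
      cycle_ranking_second_less_iff[of i n j k] by auto
  then show ?thesis
    using k(1) assms(1,2) by (auto simp: cyclic_diff_def split: if_splits)
qed

theorem theorem3:
  fixes G :: "('v, 'e) pre_digraph" and n :: nat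
  assumes "tournament G"
    and "strongly_connected G"
    and "card (verts G) = n"
    and "n \<ge> 3"
  shows "\<exists>(m::nat) (A :: nat \<Rightarrow> nat set) (f :: nat set \<Rightarrow> 'v).
    m \<ge> 3 \<and> dice_set n m A \<and> bij_betw f (A ` {1..n}) (verts G) \<and>
    (\<forall>i. 1 \<le> i \<and> i < n \<longrightarrow> prob_beats (A i) (A (i + 1)) > 1 / 2) \<and>
    prob_beats (A n) (A 1) > 1 / 2 \<and>
    (\<forall>i. 1 \<le> i \<and> i < n \<longrightarrow> prob_beats (A i) (A (i + 1)) = prob_beats (A n) (A 1)) \<and>
    (\<forall>X \<in> A ` {1..n}. \<forall>Y \<in> A ` {1..n}.
       X \<noteq> Y \<longrightarrow> prob_beats X Y > 1 / 2 \<longrightarrow> (f X, f Y) \<in> arcs_ends G)"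
proof -
  obtain xs where xs: "cycle_list G xs" "set xs = verts G"
    using strong_tournament_hamiltonian[OF assms(1,2)] by blast
  have dist: "distinct xs" and len: "length xs = n"
    using xs assms(3) distinct_card[of xs] by (auto simp: cycle_list_def)
  have arc: "(xs ! i, xs ! (if Suc i = n then 0 else Suc i)) \<in> arcs_ends G" if "i < n" for i
  proof (cases "Suc i = n")
    case True
    then have "i = length xs - 1" using len by simp
    then show ?thesis
      using xs(1) True len assms(4) by (auto simp: cycle_list_def last_conv_nth hd_conv_nth)
  next
    case False
    then show ?thesis
      using xs(1) that len by (auto simp: cycle_list_def successively_conv_nth)
  qed
  define D where "D = ranking_die n (2 * n) (cycle_ranking n)"
  define A where "A = (\<lambda>i. D (i - 1))"
  define p where "p = 1 / 2 + 1 / (2 * real n)\<^sup>2"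
  have p: "p > 1 / 2"
    using assms(4) by (simp add: p_def)
  have bij: "bij_betw (cycle_ranking n s) {..<n} {..<n}" if "s < 2 * n" for s
    using bij_betw_cycle_ranking that assms(4) by simp
  have rank_less: "cycle_ranking n s i < n" if "s < 2 * n" "i < n" for s i
    using bij_betwE[OF bij[OF that(1)]] that(2) by simp
  have dice: "dice_set n (2 * n) A"
    unfolding A_def D_def by (rule dice_set_ranking_die) (rule bij)
  have prob: "prob_beats (D i) (D j) =
      1 / 2 + (real (card {s. s < 2 * n \<and> cycle_ranking n s j < cycle_ranking n s i}) - real n)
        / (2 * real n)\<^sup>2" if "i < n" "j < n" for i j
    using prob_beats_ranking_die[of "2 * n" n "cycle_ranking n" i j] rank_less that assms(4)
    unfolding D_def by simp
  have prob_succ: "prob_beats (D i) (D (if Suc i = n then 0 else Suc i)) = p" if "i < n" for i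
  proof -
    have "(if Suc i = n then 0 else Suc i) < n" using that by auto
    from prob[OF that this] show ?thesis
      unfolding card_cycle_ranking_succ[OF assms(4) that] p_def by simp
  qed
  have prob_gt: "j = (if Suc i = n then 0 else Suc i)"
    if "i < n" "j < n" "prob_beats (D i) (D j) > 1 / 2" for i j
  proof (rule card_cycle_ranking_gt[OF that(1,2)])
    show "n < card {s. s < 2 * n \<and> cycle_ranking n s j < cycle_ranking n s i}"
      using that(3) assms(4) unfolding prob[OF that(1,2)] by (simp add: zero_less_divide_iff)
  qed
  have inj: "inj_on A {1..n}"
  proof (rule inj_onI)
    fix i j assume ij: "i \<in> {1..n}" "j \<in> {1..n}" "A i = A j"
    have "A i \<noteq> {}"
      using assms(4) by (auto simp: A_def D_def ranking_die_def lessThan_empty_iff)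
    then show "i = j"
      using dice ij unfolding dice_set_def disjoint_family_on_def by (metis Int_absorb)
  qed
  define f where "f = (\<lambda>X. xs ! (inv_into {1..n} A X - 1))"
  have f: "f (A i) = xs ! (i - 1)" if "i \<in> {1..n}" for i
    using inv_into_f_f[OF inj that] by (simp add: f_def)
  have "bij_betw (\<lambda>i. i - 1) {1..n} {..<n}"
    by (rule bij_betw_byWitness[where f' = Suc]) auto
  then have "bij_betw ((\<lambda>i. xs ! i) \<circ> (\<lambda>i. i - 1)) {1..n} (verts G)"
    by (rule bij_betw_trans) (rule bij_betw_nth[OF dist], use len xs(2) in auto)
  then have "bij_betw (f \<circ> A) {1..n} (verts G)"
    by (rule bij_betw_cong[THEN iffD1, rotated]) (simp add: f)
  then have bij_f: "bij_betw f (A ` {1..n}) (verts G)"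
    using bij_betw_comp_iff[OF inj_on_imp_bij_betw[OF inj]] by blast
  have step: "prob_beats (A i) (A (i + 1)) = p" if "1 \<le> i \<and> i < n" for i
    using prob_succ[of "i - 1"] that by (simp add: A_def less_imp_diff_less)
  have last: "prob_beats (A n) (A 1) = p"
    using prob_succ[of "n - 1"] assms(4) by (simp add: A_def)
  have realize: "(f X, f Y) \<in> arcs_ends G"
    if X: "X \<in> A ` {1..n}" and Y: "Y \<in> A ` {1..n}" and gt: "prob_beats X Y > 1 / 2" for X Y
  proof -
    obtain i j where i: "i \<in> {1..n}" "X = A i" and j: "j \<in> {1..n}" "Y = A j"
      using X Y by blast
    have "j - 1 = (if Suc (i - 1) = n then 0 else Suc (i - 1))"
      using i j gt by (intro prob_gt) (auto simp: A_def)
    then show ?thesis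
      using arc[of "i - 1"] i j f by auto
  qed
  show ?thesis
    using dice bij_f step last realize p assms(4)
    by (intro exI[of _ "2 * n"] exI[of _ A] exI[of _ f]) auto
qed

end
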